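(* Let $n\ge 1$ be an integer, $B>0$, $0<\alpha<1$, and $f(x)=x^\alpha$ for $x\ge 0$. For $p\ge 1$ consider maximizing $$U_p(\mathbf{x})=\Bigl(\sum_{i=1}^n f(x_i)^p\Bigr)^{1/p}$$ over $\mathbf{x}\in\mathcal{B}_B$, and put $p_c=1/\alpha$. Then: if $p<p_c$, the equal allocation $(B/n,\ldots,B/n)$ is the unique maximizer; if $p>p_c$, the completely specialized allocation $(B,0,\ldots,0)$, up to permutation of coordinates, is a maximizer; and if $p=p_c$, every $\mathbf{x}\in\mathcal{B}_B$ is a maximizer.
   Context: For $B>0$, $\mathcal{B}_B=\{\mathbf{x}\in[0,\infty)^n:\sum_{i=1}^n x_i=B\}$ is the set of feasible allocations. *)

theory Defs
  imports "HOL-Analysis.Analysis"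
begin

text \<open>Allocations are vectors in \<open>real ^ 'n\<close>, so the number \<open>n\<close> of coordinates is \<open>CARD('n)\<close>.\<close>

definition feasible :: "real \<Rightarrow> (real ^ 'n) set" where
  "feasible B = {x. (\<forall>i. 0 \<le> x $ i) \<and> (\<Sum>i\<in>UNIV. x $ i) = B}"

text \<open>Since \<open>0 powr a = 0\<close>, the real powers below have their usual meaning at zero
  for positive exponents.\<close>

definition U :: "(real \<Rightarrow> real) \<Rightarrow> real \<Rightarrow> real ^ 'n \<Rightarrow> real" where
  "U f p x = (\<Sum>i\<in>UNIV. f (x $ i) powr p) powr (1 / p)"

definition is_maximizer :: "(real \<Rightarrow> real) \<Rightarrow> real \<Rightarrow> real \<Rightarrow> real ^ 'n \<Rightarrow> bool" where
  "is_maximizer f p B x \<longleftrightarrow> is_arg_max (U f p) (\<lambda>y. y \<in> feasible B) x"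

definition equal_allocation :: "real \<Rightarrow> real ^ 'n" where
  "equal_allocation B = (\<chi> i. B / real CARD('n))"

text \<open>The vectors \<open>specialized_allocation k B\<close>, for \<open>k\<close> ranging over the index type, are
  exactly the coordinate permutations of \<open>(B, 0, \<dots>, 0)\<close>.\<close>

definition specialized_allocation :: "'n \<Rightarrow> real \<Rightarrow> real ^ 'n" where
  "specialized_allocation k B = (\<chi> i. if i = k then B else 0)"

end

theory Submission
  imports Defs
begin

text \<open>
  On feasible allocations the objective is a strictly increasing function of
  \<open>\<Sum>\<^sub>i x\<^sub>i powr r\<close> with \<open>r = \<alpha> p\<close>. For \<open>r < 1\<close> the strict tangent-line inequality for
  \<open>t \<mapsto> t powr r\<close> at \<open>B / n\<close>, summed over the coordinates, singles out the equal allocation;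
  for \<open>r > 1\<close> the bound \<open>(x\<^sub>i / B) powr r \<le> x\<^sub>i / B\<close> sums to \<open>1\<close>, the value at a vertex;
  for \<open>r = 1\<close> the objective is constant.
\<close>

text \<open>With \<open>w = 1 + r (s - 1)\<close>, the bound \<open>ln z < z - 1\<close> is applied at \<open>1 / w\<close> and at
  \<open>s / w\<close>: the convex combination of the two right-hand sides with weights \<open>1 - r\<close> and
  \<open>r\<close> vanishes.\<close>

lemma powr_less_tangent_at_1:
  fixes s r :: real
  assumes "0 \<le> s" "s \<noteq> 1" "0 < r" "r < 1"
  shows "s powr r < 1 + r * (s - 1)"
proof (cases "s = 0")
  \<comment> \<open>At \<open>s = 0\<close> logarithms say nothing useful, but
    \<open>0 powr r = 0\<close> reduces the claim to \<open>0 < 1 - r\<close>.\<close>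
  case True
  then show ?thesis using assms by simp
next
  case False
  with assms have s: "s > 0" by simp
  define w where "w = 1 + r * (s - 1)"
  have w_eq: "w = (1 - r) + r * s" by (simp add: w_def algebra_simps)
  have w: "w > 0" using s assms unfolding w_eq by (intro add_pos_pos) auto
  \<comment> \<open>Equality in \<open>ln z \<le> z - 1\<close> occurs only at \<open>z = 1\<close>,
    so \<open>s \<noteq> 1\<close> makes the bound at \<open>1 / w\<close> strict; the one at
    \<open>s / w\<close> may stay weak.\<close>
  have "w \<noteq> 1" using assms by (simp add: w_def)
  then have "ln (1 / w) < 1 / w - 1"
    using ln_le_minus_one[of "1 / w"] ln_eq_minus_one[of "1 / w"] w by force
  moreover have "ln (s / w) \<le> s / w - 1"
    using ln_le_minus_one[of "s / w"] s w by simp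
  ultimately have "(1 - r) * ln (1 / w) + r * ln (s / w) < (1 - r) * (1 / w - 1) + r * (s / w - 1)"
    using assms by (intro add_less_le_mono mult_strict_left_mono mult_left_mono) auto
  also have "\<dots> = ((1 - r) + r * s) / w - 1"
    by (simp add: algebra_simps flip: add_divide_distrib diff_divide_distrib)
  also have "\<dots> = 0" using w w_eq by simp
  \<comment> \<open>The weights add up to \<open>1\<close>, so the left-hand side is
    \<open>r * ln s - ln w\<close>.\<close>
  finally have "r * ln s < ln w"
    using s w by (simp add: ln_div algebra_simps)
  then have "exp (r * ln s) < exp (ln w)" by simp
  then have "s powr r < w" using s w by (simp add: powr_def)
  then show ?thesis by (simp add: w_def)
qed

text \<open>Homogeneity: the bound at \<open>1\<close> is taken at \<open>s = t / m\<close> and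
  multiplied by \<open>m powr r\<close>.\<close>

lemma powr_less_tangent:
  fixes t m r :: real
  assumes "0 \<le> t" "0 < m" "t \<noteq> m" "0 < r" "r < 1"
  shows "t powr r < m powr r + r * m powr r / m * (t - m)"
proof -
  have "(t / m) powr r < 1 + r * (t / m - 1)"
    using assms by (intro powr_less_tangent_at_1) auto
  then have "m powr r * (t / m) powr r < m powr r * (1 + r * (t / m - 1))"
    using assms by simp
  then show ?thesis using assms by (simp add: powr_divide field_simps)
qed

lemma U_powr_eq:
  assumes "\<And>t. t \<ge> 0 \<Longrightarrow> f t = t powr \<alpha>" and "x \<in> feasible B"
  shows "U f p x = (\<Sum>i\<in>UNIV. x $ i powr (\<alpha> * p)) powr (1 / p)"
  using assms by (simp add: U_def feasible_def powr_powr)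

lemma equal_allocation_feasible: "B \<ge> 0 \<Longrightarrow> equal_allocation B \<in> feasible B"
  by (simp add: equal_allocation_def feasible_def)

lemma specialized_allocation_feasible: "B \<ge> 0 \<Longrightarrow> specialized_allocation k B \<in> feasible B"
  by (simp add: specialized_allocation_def feasible_def)

lemma sum_powr_less_equal_allocation:
  fixes x :: "real ^ 'n"
  assumes "x \<in> feasible B" "x \<noteq> equal_allocation B" "B > 0" "0 < r" "r < 1"
  shows "(\<Sum>i\<in>UNIV. x $ i powr r) < (\<Sum>i\<in>UNIV. equal_allocation B $ (i :: 'n) powr r)"
proof -
  define m where "m = B / real CARD('n)"
  define c where "c = r * m powr r / m"
  have m: "m > 0" using assms by (simp add: m_def)
  have nonneg: "x $ i \<ge> 0" for i using assms by (simp add: feasible_def)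
  have strict: "x $ i powr r < m powr r + c * (x $ i - m)" if "x $ i \<noteq> m" for i
    using powr_less_tangent[of "x $ i" m r] that nonneg m assms by (simp add: c_def)
  \<comment> \<open>One coordinate off the mean gives a strict term; weak bounds suffice for the
    others.\<close>
  obtain j where "x $ j \<noteq> m"
    using assms(2) by (auto simp: equal_allocation_def vec_eq_iff m_def)
  have "x $ i powr r \<le> m powr r + c * (x $ i - m)" for i
    using strict[of i] by (cases "x $ i = m") auto
  with strict[OF \<open>x $ j \<noteq> m\<close>]
  have "(\<Sum>i\<in>UNIV. x $ i powr r) < (\<Sum>i\<in>UNIV. m powr r + c * (x $ i - m))"
    by (intro sum_strict_mono_ex1) auto
  also have "\<dots> = (\<Sum>i\<in>(UNIV :: 'n set). m powr r) + c * ((\<Sum>i\<in>UNIV. x $ i) - CARD('n) * m)"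
    by (simp add: sum.distrib sum_subtractf flip: sum_distrib_left)
  \<comment> \<open>\<open>m\<close> is the mean of the coordinates, so the linear terms cancel
    whatever the slope \<open>c\<close>.\<close>
  also have "(\<Sum>i\<in>UNIV. x $ i) - CARD('n) * m = 0"
    using assms by (simp add: feasible_def m_def)
  finally show ?thesis by (simp add: equal_allocation_def m_def)
qed

lemma sum_powr_le_specialized_allocation:
  fixes x :: "real ^ 'n"
  assumes "x \<in> feasible B" "B > 0" "1 \<le> r"
  shows "(\<Sum>i\<in>UNIV. x $ i powr r) \<le> (\<Sum>i\<in>UNIV. specialized_allocation k B $ i powr r)"
proof -
  have nonneg: "x $ i \<ge> 0" for i using assms by (simp add: feasible_def)
  have total: "(\<Sum>i\<in>UNIV. x $ i) = B" using assms by (simp add: feasible_def)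
  have "x $ i powr r \<le> B powr r * (x $ i / B)" for i
  proof -
    have "x $ i \<le> B"
      using member_le_sum[of i UNIV "\<lambda>i. x $ i"] nonneg total by simp
    \<comment> \<open>The ratio lies in \<open>[0, 1]\<close>, where raising the exponent from
      \<open>1\<close> to \<open>r\<close> cannot increase the power.\<close>
    then have "(x $ i / B) powr r \<le> (x $ i / B) powr 1"
      using nonneg assms by (intro powr_mono') auto
    then show ?thesis using nonneg[of i] assms by (simp add: powr_divide field_simps)
  qed
  then have "(\<Sum>i\<in>UNIV. x $ i powr r) \<le> (\<Sum>i\<in>UNIV. B powr r * (x $ i / B))"
    by (rule sum_mono)
  also have "\<dots> = B powr r"
    using assms total by (simp flip: sum_distrib_left sum_divide_distrib)
  also have "\<dots> = (\<Sum>i\<in>UNIV. specialized_allocation k B $ i powr r)"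
    by (simp add: specialized_allocation_def if_distrib[of "\<lambda>t. t powr r"] cong: if_cong)
  finally show ?thesis .
qed

theorem corollary4p4:
  fixes B \<alpha> p p\<^sub>c :: real and f :: "real \<Rightarrow> real"
  assumes "B > 0" and "0 < \<alpha>" and "\<alpha> < 1"
    and "\<And>x. x \<ge> 0 \<Longrightarrow> f x = x powr \<alpha>"
    and "p \<ge> 1" and "p\<^sub>c = 1 / \<alpha>"
  shows "(p < p\<^sub>c \<longrightarrow>
            (\<forall>x :: real ^ 'n. is_maximizer f p B x \<longleftrightarrow> x = equal_allocation B)) \<and>
         (p > p\<^sub>c \<longrightarrow>
            (\<forall>k :: 'n. is_maximizer f p B (specialized_allocation k B))) \<and>
         (p = p\<^sub>c \<longrightarrow>
            (\<forall>x \<in> (feasible B :: (real ^ 'n) set). is_maximizer f p B x))"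
proof (intro conjI impI allI ballI)
  define r where "r = \<alpha> * p"
  have r: "r > 0" using assms by (simp add: r_def)
  have U: "U f p y = (\<Sum>i\<in>UNIV. y $ i powr r) powr (1 / p)" if "y \<in> feasible B" for y :: "real ^ 'n"
    using U_powr_eq[OF assms(4) that] by (simp add: r_def)
  {
    fix x :: "real ^ 'n"
    assume "p < p\<^sub>c"
    then have "r < 1" using assms by (simp add: r_def field_simps)
    have feas: "equal_allocation B \<in> (feasible B :: (real ^ 'n) set)"
      using assms by (simp add: equal_allocation_feasible)
    have "U f p y < U f p (equal_allocation B :: real ^ 'n)"
      if "y \<in> feasible B" "y \<noteq> equal_allocation B" for y :: "real ^ 'n"
      unfolding U[OF that(1)] U[OF feas]
      using sum_powr_less_equal_allocation[OF that \<open>B > 0\<close> r \<open>r < 1\<close>] assms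
      by (intro powr_less_mono2 sum_nonneg) auto
    \<comment> \<open>Strictness gives both directions: no feasible point beats the equal
      allocation, and it beats every other one.\<close>
    then show "is_maximizer f p B x \<longleftrightarrow> x = equal_allocation B"
      using feas unfolding is_maximizer_def is_arg_max_def by (metis less_asym)
  next
    fix k :: 'n
    assume "p > p\<^sub>c"
    then have "1 \<le> r" using assms by (simp add: r_def field_simps)
    have feas: "specialized_allocation k B \<in> feasible B"
      using assms by (simp add: specialized_allocation_feasible)
    have "U f p y \<le> U f p (specialized_allocation k B)" if "y \<in> feasible B" for y :: "real ^ 'n"
      unfolding U[OF that] U[OF feas]
      using sum_powr_le_specialized_allocation[OF that \<open>B > 0\<close> \<open>1 \<le> r\<close>] assms
      by (intro powr_mono2 sum_nonneg) auto
    then show "is_maximizer f p B (specialized_allocation k B)"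
      using feas unfolding is_maximizer_def is_arg_max_def by (meson not_less)
  next
    fix x :: "real ^ 'n"
    assume "p = p\<^sub>c" and x: "x \<in> feasible B"
    then have "r = 1" using assms by (simp add: r_def)
    \<comment> \<open>Since \<open>t powr 1 = t\<close> for \<open>t \<ge> 0\<close>, the inner sum
      is the budget \<open>B\<close>.\<close>
    then have "U f p y = B powr (1 / p)" if "y \<in> feasible B" for y :: "real ^ 'n"
      using U[OF that] that by (simp add: feasible_def)
    then show "is_maximizer f p B x"
      using x by (simp add: is_maximizer_def is_arg_max_def)
  }
qed

end
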